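(* Let $A$ be an ordered commutative monoid with generating pair $(g_+,g_-)$. Then the following are equivalent for any $x,y\in A$: (a) $x\geq y$ in $\mathrm{aovs}_{\mathbb{Q}}(A)$; (b) for all rational $\varepsilon>0$ there exist $n\in\mathbb{N}$ with $n\geq 1$ and $k\in\mathbb{N}$ with $k\leq\varepsilon n$ and $nx+kg_+\geq ny+kg_-$ in $A$; (c) $f(x)\geq f(y)$ for all functionals $f:A\to\mathbb{R}$.
   Context: $\mathbb{N}=\{0,1,2,\dots\}$. An ordered commutative monoid is a set $A$ with a partial order $\geq$ and a commutative monoid structure $(+,0)$ such that $x\geq y$ implies $x+z\geq y+z$; $nx$ denotes the $n$-fold sum. A functional on $A$ is a map $f:A\to\mathbb{R}$ with $x\geq y\Rightarrow f(x)\geq f(y)$, $f(x+y)=f(x)+f(y)$, $f(0)=0$. A generating pair is a pair $g_+,g_-\in A$ with $g_+\geq g_-$ such that for every $x\in A$ there is $n\in\mathbb{N}$ with $ng_+\geq x+ng_-$ and $ng_++x\geq ng_-$. Regularizations (in each case, elements ordered both ways are identified): - $\mathrm{oag}(A)$ is the abelian group of formal differences $x-y$ ($x,y\in A$), with $x-y\geq x'-y'$ iff there is $z\in A$ with $x+y'+z\geq x'+y+z$ in $A$. - $\mathrm{ovs}_{\mathbb{Q}}(A)$ is the $\mathbb{Q}$-vector space of formal fractions $\tfrac1n u$ ($n\geq 1$, $u\in\mathrm{oag}(A)$), with $\tfrac1m u\geq\tfrac1n v$ iff there is an integer $j\geq1$ with $jnu\geq jmv$ in $\mathrm{oag}(A)$.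 It is an ordered $\mathbb{Q}$-vector space with positive cone the set of elements $\geq 0$. - For an ordered $\mathbb{Q}$-vector space $V$ with positive cone $V_+$, call $U\subseteq V$ absolutely convex if it is closed under convex combinations with rational coefficients and $V_+\subseteq U$, and absorbent if for every $v\in V$ there is a rational $\mu>0$ with $\mu v\in U$. Then $\mathrm{aovs}_{\mathbb{Q}}(V)$ is $V$ with new positive cone the intersection of all absolutely convex absorbent subsets of $V$; $\mathrm{aovs}_{\mathbb{Q}}(A):=\mathrm{aovs}_{\mathbb{Q}}(\mathrm{ovs}_{\mathbb{Q}}(A))$. "$x\geq y$ in $\mathrm{aovs}_{\mathbb{Q}}(A)$" refers to the images of $x,y$ under the canonical homomorphism $A\to\mathrm{aovs}_{\mathbb{Q}}(A)$. *)

theory Defs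
  imports Complex_Main
begin

text \<open>
  Ordered commutative monoids are the library's type class
  \<^class>\<open>ordered_comm_monoid_add\<close>: a partial order and a commutative monoid
  with translation-invariant order.
\<close>

definition nmult :: "nat \<Rightarrow> 'a::comm_monoid_add \<Rightarrow> 'a" (infixr "\<cdot>" 75)
  where "n \<cdot> x = (\<Sum>i<n. x)"

definition zmult :: "int \<Rightarrow> 'a::ab_group_add \<Rightarrow> 'a" (infixr "\<cdot>\<^sub>Z" 75)
  where "k \<cdot>\<^sub>Z u = nat k \<cdot> u - nat (- k) \<cdot> u"

definition generating_pair :: "'a::ordered_comm_monoid_add \<Rightarrow> 'a \<Rightarrow> bool"
  where "generating_pair gp gm \<longleftrightarrow>
    gp \<ge> gm \<and> (\<forall>x. \<exists>n. n \<cdot> gp \<ge> x + n \<cdot> gm \<and> n \<cdot> gp + x \<ge> n \<cdot> gm)"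

definition monoid_functional :: "('a::ordered_comm_monoid_add \<Rightarrow> real) \<Rightarrow> bool"
  where "monoid_functional f \<longleftrightarrow>
    (\<forall>x y. x \<ge> y \<longrightarrow> f x \<ge> f y) \<and> (\<forall>x y. f (x + y) = f x + f y) \<and> f 0 = 0"

lemma nmult_0 [simp]: "0 \<cdot> x = 0"
  and nmult_1 [simp]: "Suc 0 \<cdot> x = x"
  and nmult_zero [simp]: "n \<cdot> (0::'a::comm_monoid_add) = 0"
  by (simp_all add: nmult_def)

lemma nmult_Suc: "Suc n \<cdot> x = x + n \<cdot> x"
  by (simp add: nmult_def add.commute)

lemma nmult_add_left: "(m + n) \<cdot> x = m \<cdot> x + n \<cdot> x"
  by (induction m) (simp_all add: nmult_Suc add.assoc)

lemma nmult_add_right: "n \<cdot> (x + y) = n \<cdot> x + n \<cdot> y"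
  by (simp add: nmult_def sum.distrib)

lemma nmult_nmult: "m \<cdot> n \<cdot> x = (m * n) \<cdot> x"
  by (induction m) (simp_all add: nmult_Suc nmult_add_left)

lemma nmult_minus: "n \<cdot> (- x) = - (n \<cdot> (x::'a::ab_group_add))"
  by (simp add: nmult_def sum_negf)

lemma nmult_mono: "x \<le> y \<Longrightarrow> n \<cdot> x \<le> n \<cdot> (y::'a::ordered_comm_monoid_add)"
  by (simp add: nmult_def sum_mono)

lemma zmult_diff: "(int m - int n) \<cdot>\<^sub>Z u = m \<cdot> u - n \<cdot> u"
proof -
  have "nat (int m - int n) + n = nat (- (int m - int n)) + m"
    by simp
  then have "nat (int m - int n) \<cdot> u + n \<cdot> u = nat (- (int m - int n)) \<cdot> u + m \<cdot> u"
    by (metis nmult_add_left)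
  then show ?thesis
    unfolding zmult_def by (simp add: algebra_simps)
qed

lemma zmult_of_nat: "int n \<cdot>\<^sub>Z u = n \<cdot> u"
  using zmult_diff[of n 0 u] by simp

lemma zmult_add_left: "(k + l) \<cdot>\<^sub>Z u = k \<cdot>\<^sub>Z u + l \<cdot>\<^sub>Z u"
proof -
  obtain a b c d where "k = int a - int b" "l = int c - int d"
    by (metis int_diff_cases)
  moreover have "k + l = int (a + c) - int (b + d)"
    using calculation by simp
  ultimately show ?thesis
    by (simp only: zmult_diff nmult_add_left) simp
qed

lemma zmult_add_right: "k \<cdot>\<^sub>Z (u + v) = k \<cdot>\<^sub>Z u + k \<cdot>\<^sub>Z v"
  by (simp add: zmult_def nmult_add_right)

lemma nmult_zmult: "n \<cdot> k \<cdot>\<^sub>Z u = (int n * k) \<cdot>\<^sub>Z u"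
  by (induction n) (simp_all add: nmult_Suc zmult_add_left distrib_right zmult_of_nat [of 0, simplified])

lemma zmult_minus_left: "(- k) \<cdot>\<^sub>Z u = - (k \<cdot>\<^sub>Z u)"
  by (simp add: zmult_def)

lemma zmult_zmult: "k \<cdot>\<^sub>Z l \<cdot>\<^sub>Z u = (k * l) \<cdot>\<^sub>Z u"
proof (cases k)
  case (nonneg n)
  then show ?thesis by (simp add: zmult_of_nat nmult_zmult)
next
  case (neg n)
  then show ?thesis
    by (simp only: neg zmult_minus_left zmult_of_nat nmult_zmult mult_minus_left)
qed

lemma zmult_nmult: "k \<cdot>\<^sub>Z n \<cdot> u = (k * int n) \<cdot>\<^sub>Z u"
  by (metis zmult_zmult zmult_of_nat)


section \<open>The ordered abelian group of formal differences\<close>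

text \<open>The pair \<open>(x, y)\<close> stands for the formal difference \<open>x - y\<close>.\<close>

fun oag_ge :: "'a::ordered_comm_monoid_add \<times> 'a \<Rightarrow> 'a \<times> 'a \<Rightarrow> bool"
  where "oag_ge (x, y) (x', y') \<longleftrightarrow> (\<exists>z. x + y' + z \<ge> x' + y + z)"

lemma oag_ge_refl: "oag_ge p p"
  by (cases p) auto

lemma oag_ge_trans:
  assumes "oag_ge p q" "oag_ge q r"
  shows "oag_ge p r"
proof -
  obtain a b c d e f where p: "p = (a, b)" "q = (c, d)" "r = (e, f)"
    by (metis surj_pair)
  obtain z w where z: "c + b + z \<le> a + d + z" and w: "e + d + w \<le> c + f + w"
    using assms p by auto
  have "e + b + (z + w + c + d) = (c + b + z) + (e + d + w)"
    by (simp add: ac_simps)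
  also have "\<dots> \<le> (a + d + z) + (c + f + w)"
    using z w by (rule add_mono)
  also have "\<dots> = a + f + (z + w + c + d)"
    by (simp add: ac_simps)
  finally show ?thesis
    using p by auto
qed

quotient_type (overloaded) 'a oag = "'a::ordered_comm_monoid_add \<times> 'a" /
  "\<lambda>p q. oag_ge p q \<and> oag_ge q p"
  by (intro equivpI reflpI sympI transpI) (auto intro: oag_ge_refl oag_ge_trans)

lemma oag_ge_add:
  assumes "oag_ge (a, b) (a', b')" "oag_ge (c, d) (c', d')"
  shows "oag_ge (a + c, b + d) (a' + c', b' + d')"
proof -
  obtain z w where z: "a' + b + z \<le> a + b' + z" and w: "c' + d + w \<le> c + d' + w"
    using assms by auto
  have "(a' + c') + (b + d) + (z + w) = (a' + b + z) + (c' + d + w)"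
    by (simp add: ac_simps)
  also have "\<dots> \<le> (a + b' + z) + (c + d' + w)"
    using z w by (rule add_mono)
  also have "\<dots> = (a + c) + (b' + d') + (z + w)"
    by (simp add: ac_simps)
  finally show ?thesis by auto
qed

instantiation oag :: (ordered_comm_monoid_add) ordered_ab_group_add
begin

lift_definition zero_oag :: "'a oag" is "(0, 0)" .

lift_definition plus_oag :: "'a oag \<Rightarrow> 'a oag \<Rightarrow> 'a oag"
  is "\<lambda>(x, y) (x', y'). (x + x', y + y')"
  using oag_ge_add by (clarsimp simp del: oag_ge.simps) blast

lift_definition uminus_oag :: "'a oag \<Rightarrow> 'a oag" is "\<lambda>(x, y). (y, x)"
  by (auto simp: ac_simps)

definition minus_oag :: "'a oag \<Rightarrow> 'a oag \<Rightarrow> 'a oag"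
  where "minus_oag u v = u + - v"

lift_definition less_eq_oag :: "'a oag \<Rightarrow> 'a oag \<Rightarrow> bool" is "\<lambda>p q. oag_ge q p"
  by (meson oag_ge_trans)

definition less_oag :: "'a oag \<Rightarrow> 'a oag \<Rightarrow> bool"
  where "less_oag u v \<longleftrightarrow> u \<le> v \<and> \<not> v \<le> u"

instance
proof
  fix a b c :: "'a oag"
  show "a + b + c = a + (b + c)"
    by transfer (auto simp: ac_simps)
  show "a + b = b + a"
    by transfer (auto simp: ac_simps)
  show "0 + a = a"
    by transfer auto
  show "- a + a = 0"
    by transfer (auto simp: ac_simps)
  show "a - b = a + - b"
    by (rule minus_oag_def)
  show "a < b \<longleftrightarrow> a \<le> b \<and> \<not> b \<le> a"
    by (rule less_oag_def)
  show "a \<le> a"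
    by transfer (rule oag_ge_refl)
  show "a \<le> b \<Longrightarrow> b \<le> c \<Longrightarrow> a \<le> c"
    by transfer (rule oag_ge_trans)
  show "a \<le> b \<Longrightarrow> b \<le> a \<Longrightarrow> a = b"
    by transfer simp
  show "a \<le> b \<Longrightarrow> c + a \<le> c + b"
    by transfer (auto simp del: oag_ge.simps intro: oag_ge_add oag_ge_refl)
qed

end

lift_definition to_oag :: "'a::ordered_comm_monoid_add \<Rightarrow> 'a oag" is "\<lambda>x. (x, 0)" .

lemma to_oag_zero: "to_oag 0 = 0"
  and to_oag_add: "to_oag (x + y) = to_oag x + to_oag y"
  and to_oag_mono: "x \<ge> y \<Longrightarrow> to_oag x \<ge> to_oag y"
  by (transfer, simp add: add_right_mono)+

lifting_forget oag.lifting


section \<open>Ordered vector spaces over the rationals\<close>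

class scaleQ =
  fixes scaleQ :: "rat \<Rightarrow> 'a \<Rightarrow> 'a" (infixr "*\<^sub>Q" 75)

class ordered_rat_vector = scaleQ + ordered_ab_group_add +
  assumes scaleQ_add_right: "q *\<^sub>Q (u + v) = q *\<^sub>Q u + q *\<^sub>Q v"
    and scaleQ_add_left: "(p + q) *\<^sub>Q u = p *\<^sub>Q u + q *\<^sub>Q u"
    and scaleQ_scaleQ: "p *\<^sub>Q q *\<^sub>Q u = (p * q) *\<^sub>Q u"
    and scaleQ_one [simp]: "1 *\<^sub>Q u = u"
    and scaleQ_left_mono: "0 \<le> q \<Longrightarrow> u \<le> v \<Longrightarrow> q *\<^sub>Q u \<le> q *\<^sub>Q v"

lemma vector_space_scaleQ: "vector_space (scaleQ :: rat \<Rightarrow> 'v \<Rightarrow> 'v::ordered_rat_vector)"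
  by unfold_locales (simp_all add: scaleQ_add_right scaleQ_add_left scaleQ_scaleQ)

lemmas module_scaleQ = vector_space_scaleQ[folded module_iff_vector_space]
lemmas scaleQ_zero_left [simp] = module.scale_zero_left[OF module_scaleQ]
lemmas scaleQ_zero_right [simp] = module.scale_zero_right[OF module_scaleQ]
lemmas scaleQ_minus_left = module.scale_minus_left[OF module_scaleQ]
lemmas scaleQ_minus_right = module.scale_minus_right[OF module_scaleQ]
lemmas scaleQ_diff_right = module.scale_right_diff_distrib[OF module_scaleQ]


section \<open>The ordered rational vector space of formal fractions\<close>

text \<open>The pair \<open>(n, u)\<close> with \<open>n \<ge> 1\<close> stands for the formal fraction \<open>1/n u\<close>.\<close>

fun ovs_ge :: "nat \<times> 'a::ordered_comm_monoid_add oag \<Rightarrow> nat \<times> 'a oag \<Rightarrow> bool"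
  where "ovs_ge (m, u) (n, v) \<longleftrightarrow> (\<exists>j\<ge>1. (j * n) \<cdot> u \<ge> (j * m) \<cdot> v)"

lemma ovs_ge_refl: "ovs_ge p p"
  by (cases p) auto

lemma ovs_ge_trans:
  assumes "ovs_ge p q" "ovs_ge q r" "fst q \<ge> 1"
  shows "ovs_ge p r"
proof -
  obtain l m n u v w where p: "p = (l, u)" "q = (m, v)" "r = (n, w)"
    by (metis surj_pair)
  obtain i j where i: "i \<ge> 1" "(i * l) \<cdot> v \<le> (i * m) \<cdot> u"
    and j: "j \<ge> 1" "(j * m) \<cdot> w \<le> (j * n) \<cdot> v"
    using assms p by auto
  have "(i * j * m * l) \<cdot> w = (i * l) \<cdot> (j * m) \<cdot> w"
    by (simp add: nmult_nmult ac_simps)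
  also have "\<dots> \<le> (i * l) \<cdot> (j * n) \<cdot> v"
    using j by (intro nmult_mono)
  also have "\<dots> = (j * n) \<cdot> (i * l) \<cdot> v"
    by (simp add: nmult_nmult ac_simps)
  also have "\<dots> \<le> (j * n) \<cdot> (i * m) \<cdot> u"
    using i by (intro nmult_mono)
  also have "\<dots> = (i * j * m * n) \<cdot> u"
    by (simp add: nmult_nmult ac_simps)
  finally have "(i * j * m * l) \<cdot> w \<le> (i * j * m * n) \<cdot> u" .
  moreover have "i * j * m \<ge> 1"
    using i j assms p by simp
  ultimately show ?thesis
    unfolding p ovs_ge.simps by blast
qed

quotient_type (overloaded) 'a ovs = "nat \<times> 'a::ordered_comm_monoid_add oag" /
  partial: "\<lambda>p q. fst p \<ge> 1 \<and> fst q \<ge> 1 \<and> ovs_ge p q \<and> ovs_ge q p"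
proof (intro part_equivpI sympI transpI)
  show "\<exists>p::nat \<times> 'a oag. fst p \<ge> 1 \<and> fst p \<ge> 1 \<and> ovs_ge p p \<and> ovs_ge p p"
    by (rule exI[of _ "(1, 0)"]) auto
qed (auto intro: ovs_ge_trans simp del: ovs_ge.simps)

text \<open>Addition and scaling follow
  \<open>1/m u + 1/n v = 1/(m n) (n u + m v)\<close> and \<open>(a/b) (1/n u) = 1/(b n) (a u)\<close>.\<close>

lemma ovs_ge_add:
  assumes "ovs_ge (m, u) (m', u')" "ovs_ge (n, v) (n', v')"
  shows "ovs_ge (m * n, n \<cdot> u + m \<cdot> v) (m' * n', n' \<cdot> u' + m' \<cdot> v')"
proof -
  obtain i j where i: "i \<ge> 1" "(i * m) \<cdot> u' \<le> (i * m') \<cdot> u"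
    and j: "j \<ge> 1" "(j * n) \<cdot> v' \<le> (j * n') \<cdot> v"
    using assms by auto
  have "(i * j * (m * n)) \<cdot> (n' \<cdot> u' + m' \<cdot> v')
      = (j * n * n') \<cdot> (i * m) \<cdot> u' + (i * m * m') \<cdot> (j * n) \<cdot> v'"
    by (simp add: nmult_add_right nmult_nmult ac_simps)
  also have "\<dots> \<le> (j * n * n') \<cdot> (i * m') \<cdot> u + (i * m * m') \<cdot> (j * n') \<cdot> v"
    using i j by (intro add_mono nmult_mono)
  also have "\<dots> = (i * j * (m' * n')) \<cdot> (n \<cdot> u + m \<cdot> v)"
    by (simp add: nmult_add_right nmult_nmult ac_simps)
  finally show ?thesis
    using i j by (auto intro!: exI[of _ "i * j"])
qed

lemma ovs_ge_nmult:
  assumes "ovs_ge (m, u) (n, v)"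
  shows "ovs_ge (m * b, a \<cdot> u) (n * b, a \<cdot> v)"
proof -
  obtain j where j: "j \<ge> 1" "(j * m) \<cdot> v \<le> (j * n) \<cdot> u"
    using assms by auto
  have "(b * a) \<cdot> (j * m) \<cdot> v \<le> (b * a) \<cdot> (j * n) \<cdot> u"
    using j by (intro nmult_mono)
  then show ?thesis
    using j by (auto simp: nmult_nmult ac_simps intro!: exI[of _ j])
qed

lemma ovs_ge_uminus: "ovs_ge (m, - u) (n, - v) \<longleftrightarrow> ovs_ge (n, v) (m, u)"
  by (simp add: nmult_minus)

lemma ovs_ge_zmult:
  assumes "ovs_ge (m, u) (n, v)" "ovs_ge (n, v) (m, u)"
  shows "ovs_ge (m * b, a \<cdot>\<^sub>Z u) (n * b, a \<cdot>\<^sub>Z v)"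
proof (cases a)
  case (nonneg k)
  then show ?thesis
    using ovs_ge_nmult assms by (simp add: zmult_of_nat del: ovs_ge.simps)
next
  case (neg k)
  show ?thesis
    unfolding neg zmult_minus_left zmult_of_nat ovs_ge_uminus
    using ovs_ge_nmult assms(2) .
qed

lemma ovs_ge_eqI:
  assumes "n \<cdot> u = m \<cdot> v"
  shows "ovs_ge (m, u) (n, v)" "ovs_ge (n, v) (m, u)"
  unfolding ovs_ge.simps using assms by (metis mult_1 order_refl)+

lemma ovs_ge_1I: "u \<ge> v \<Longrightarrow> ovs_ge (Suc 0, u) (Suc 0, v)"
  unfolding ovs_ge.simps by (metis mult_1 nmult_mono order_refl)

instantiation ovs :: (ordered_comm_monoid_add) ordered_rat_vector
begin

lift_definition zero_ovs :: "'a ovs" is "(1, 0)"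
  by (simp add: ovs_ge_refl del: ovs_ge.simps)

lift_definition plus_ovs :: "'a ovs \<Rightarrow> 'a ovs \<Rightarrow> 'a ovs"
  is "\<lambda>(m, u) (n, v). (m * n, n \<cdot> u + m \<cdot> v)"
  by (auto simp del: ovs_ge.simps intro: ovs_ge_add)

lift_definition uminus_ovs :: "'a ovs \<Rightarrow> 'a ovs" is "\<lambda>(n, u). (n, - u)"
  by (auto simp del: ovs_ge.simps simp: ovs_ge_uminus)

definition minus_ovs :: "'a ovs \<Rightarrow> 'a ovs \<Rightarrow> 'a ovs"
  where "minus_ovs u v = u + - v"

lift_definition scaleQ_ovs :: "rat \<Rightarrow> 'a ovs \<Rightarrow> 'a ovs"
  is "\<lambda>q (n, u). case quotient_of q of (a, b) \<Rightarrow> (n * nat b, a \<cdot>\<^sub>Z u)"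
  by (auto simp del: ovs_ge.simps simp: Suc_le_eq quotient_of_denom_pos
      split: prod.splits intro: ovs_ge_zmult)

lift_definition less_eq_ovs :: "'a ovs \<Rightarrow> 'a ovs \<Rightarrow> bool" is "\<lambda>p q. ovs_ge q p"
  by (meson ovs_ge_trans)

definition less_ovs :: "'a ovs \<Rightarrow> 'a ovs \<Rightarrow> bool"
  where "less_ovs u v \<longleftrightarrow> u \<le> v \<and> \<not> v \<le> u"

instance
proof
  fix u v w :: "'a ovs" and p q :: rat
  show "u + v + w = u + (v + w)"
    by transfer (auto simp: nmult_add_right nmult_nmult ac_simps Suc_le_eq)
  show "u + v = v + u"
    by transfer (auto simp: ac_simps Suc_le_eq)
  show "0 + u = u"
    by transfer (auto simp: Suc_le_eq)
  show "- u + u = 0"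
    by transfer (auto simp: Suc_le_eq nmult_minus)
  show "u - v = u + - v"
    by (rule minus_ovs_def)
  show "u < v \<longleftrightarrow> u \<le> v \<and> \<not> v \<le> u"
    by (rule less_ovs_def)
  show "u \<le> u"
    by transfer (simp add: ovs_ge_refl del: ovs_ge.simps)
  show "u \<le> v \<Longrightarrow> v \<le> w \<Longrightarrow> u \<le> w"
    by transfer (metis ovs_ge_trans)
  show "u \<le> v \<Longrightarrow> v \<le> u \<Longrightarrow> u = v"
    by transfer simp
  show "u \<le> v \<Longrightarrow> w + u \<le> w + v"
    by transfer (auto simp del: ovs_ge.simps intro: ovs_ge_add ovs_ge_refl)
  show "q *\<^sub>Q (u + v) = q *\<^sub>Q u + q *\<^sub>Q v"
  proof (transfer, clarsimp simp del: ovs_ge.simps one_le_mult_iff split: prod.splits)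
    fix q :: rat and m n :: nat and u v :: "'a oag" and a b
    assume mn: "Suc 0 \<le> m" "Suc 0 \<le> n" and ab: "quotient_of q = (a, b)"
    obtain d where d: "b = int d" "d \<ge> 1"
      using quotient_of_denom_pos[OF ab] by (metis One_nat_def Suc_leI of_nat_0_less_iff zero_less_imp_eq_int)
    let ?P = "(m * n * nat b, a \<cdot>\<^sub>Z (n \<cdot> u + m \<cdot> v))"
      and ?Q = "(m * nat b * (n * nat b), (n * nat b) \<cdot> a \<cdot>\<^sub>Z u + (m * nat b) \<cdot> a \<cdot>\<^sub>Z v)"
    have "(m * nat b * (n * nat b)) \<cdot> a \<cdot>\<^sub>Z (n \<cdot> u + m \<cdot> v)
        = (m * n * nat b) \<cdot> ((n * nat b) \<cdot> a \<cdot>\<^sub>Z u + (m * nat b) \<cdot> a \<cdot>\<^sub>Z v)"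
      by (simp add: d zmult_add_right nmult_add_right zmult_nmult nmult_zmult ac_simps)
    from ovs_ge_eqI[OF this] mn d
    show "Suc 0 \<le> m * n * nat b \<and> Suc 0 \<le> m * nat b * (n * nat b) \<and> ovs_ge ?P ?Q \<and> ovs_ge ?Q ?P"
      by (simp add: Suc_le_eq del: ovs_ge.simps)
  qed
  show "(p + q) *\<^sub>Q u = p *\<^sub>Q u + q *\<^sub>Q u"
  proof (transfer, clarsimp simp del: ovs_ge.simps one_le_mult_iff split: prod.splits)
    fix p q :: rat and n :: nat and u :: "'a oag" and a b a' b' c d
    assume n: "Suc 0 \<le> n" and p: "quotient_of p = (a, b)" and q: "quotient_of q = (a', b')"
      and pq: "quotient_of (p + q) = (c, d)"
    obtain k k' l where k: "b = int k" "k \<ge> 1" "b' = int k'" "k' \<ge> 1" "d = int l" "l \<ge> 1"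
      using quotient_of_denom_pos[OF p] quotient_of_denom_pos[OF q] quotient_of_denom_pos[OF pq]
      by (metis One_nat_def Suc_leI of_nat_0_less_iff zero_less_imp_eq_int)
    have "of_int c / of_int d = (of_int a / of_int b + of_int a' / of_int b' :: rat)"
      using quotient_of_div[OF p] quotient_of_div[OF q] quotient_of_div[OF pq] by simp
    then have "of_int (c * (b * b')) = (of_int ((a * b' + a' * b) * d) :: rat)"
      using k by (simp add: field_simps)
    then have eq: "c * (b * b') = (a * b' + a' * b) * d"
      by (simp only: of_int_eq_iff)
    let ?P = "(n * nat d, c \<cdot>\<^sub>Z u)"
      and ?Q = "(n * nat b * (n * nat b'), (n * nat b') \<cdot> a \<cdot>\<^sub>Z u + (n * nat b) \<cdot> a' \<cdot>\<^sub>Z u)"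
    have "(n * nat b * (n * nat b')) \<cdot> c \<cdot>\<^sub>Z u = (int n * int n * (c * (b * b'))) \<cdot>\<^sub>Z u"
      by (simp add: k nmult_zmult ac_simps)
    also have "\<dots> = (n * nat d) \<cdot> ((n * nat b') \<cdot> a \<cdot>\<^sub>Z u + (n * nat b) \<cdot> a' \<cdot>\<^sub>Z u)"
      unfolding eq by (simp add: k nmult_zmult nmult_add_right ring_distribs zmult_add_left ac_simps)
    finally have "(n * nat b * (n * nat b')) \<cdot> c \<cdot>\<^sub>Z u
        = (n * nat d) \<cdot> ((n * nat b') \<cdot> a \<cdot>\<^sub>Z u + (n * nat b) \<cdot> a' \<cdot>\<^sub>Z u)" .
    from ovs_ge_eqI[OF this] n k
    show "Suc 0 \<le> n * nat d \<and> Suc 0 \<le> n * nat b * (n * nat b') \<and> ovs_ge ?P ?Q \<and> ovs_ge ?Q ?P"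
      by (simp add: Suc_le_eq del: ovs_ge.simps)
  qed
  show "p *\<^sub>Q q *\<^sub>Q u = (p * q) *\<^sub>Q u"
  proof (transfer, clarsimp simp del: ovs_ge.simps one_le_mult_iff split: prod.splits)
    fix p q :: rat and n :: nat and u :: "'a oag" and a b a' b' c d
    assume n: "Suc 0 \<le> n" and q: "quotient_of q = (a, b)" and p: "quotient_of p = (a', b')"
      and pq: "quotient_of (p * q) = (c, d)"
    obtain k k' l where k: "b = int k" "k \<ge> 1" "b' = int k'" "k' \<ge> 1" "d = int l" "l \<ge> 1"
      using quotient_of_denom_pos[OF p] quotient_of_denom_pos[OF q] quotient_of_denom_pos[OF pq]
      by (metis One_nat_def Suc_leI of_nat_0_less_iff zero_less_imp_eq_int)
    have "of_int c / of_int d = ((of_int a' / of_int b') * (of_int a / of_int b) :: rat)"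
      using quotient_of_div[OF p] quotient_of_div[OF q] quotient_of_div[OF pq] by simp
    then have "of_int (c * (b * b')) = (of_int (a' * a * d) :: rat)"
      using k by (simp add: field_simps)
    then have eq: "c * (b * b') = a' * a * d"
      by (simp only: of_int_eq_iff)
    let ?P = "(n * nat b * nat b', a' \<cdot>\<^sub>Z a \<cdot>\<^sub>Z u)" and ?Q = "(n * nat d, c \<cdot>\<^sub>Z u)"
    have "(n * nat d) \<cdot> a' \<cdot>\<^sub>Z a \<cdot>\<^sub>Z u = (int n * (a' * a * d)) \<cdot>\<^sub>Z u"
      by (simp add: k nmult_zmult zmult_zmult ac_simps)
    also have "\<dots> = (n * nat b * nat b') \<cdot> c \<cdot>\<^sub>Z u"
      unfolding eq[symmetric] by (simp add: k nmult_zmult ac_simps)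
    finally have "(n * nat d) \<cdot> a' \<cdot>\<^sub>Z a \<cdot>\<^sub>Z u = (n * nat b * nat b') \<cdot> c \<cdot>\<^sub>Z u" .
    from ovs_ge_eqI[OF this] n k
    show "Suc 0 \<le> n * nat b * nat b' \<and> Suc 0 \<le> n * nat d \<and> ovs_ge ?P ?Q \<and> ovs_ge ?Q ?P"
      by (simp add: Suc_le_eq del: ovs_ge.simps)
  qed
  show "1 *\<^sub>Q u = u"
    by transfer (auto simp: Suc_le_eq zmult_of_nat [of 1, simplified])
  show "q *\<^sub>Q u \<le> q *\<^sub>Q v" if "0 \<le> q" "u \<le> v"
    using that
  proof (transfer, clarsimp simp del: ovs_ge.simps one_le_mult_iff split: prod.splits)
    fix q :: rat and m n :: nat and u v :: "'a oag" and a b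
    assume q: "quotient_of q = (a, b)" "0 \<le> q" and ge: "ovs_ge (n, v) (m, u)"
    have "0 \<le> a"
      using quotient_of_div[OF q(1)] quotient_of_denom_pos[OF q(1)] q(2)
      by (simp add: zero_le_divide_iff)
    then obtain k where "a = int k"
      using nonneg_int_cases by blast
    then show "ovs_ge (n * nat b, a \<cdot>\<^sub>Z v) (m * nat b, a \<cdot>\<^sub>Z u)"
      using ovs_ge_nmult[OF ge] by (simp add: zmult_of_nat del: ovs_ge.simps)
  qed
qed

end

lift_definition oag_to_ovs :: "'a::ordered_comm_monoid_add oag \<Rightarrow> 'a ovs" is "\<lambda>u. (1, u)"
  by (simp add: ovs_ge_refl del: ovs_ge.simps)

lemma oag_to_ovs_zero: "oag_to_ovs 0 = 0"
  and oag_to_ovs_add: "oag_to_ovs (u + v) = oag_to_ovs u + oag_to_ovs v"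
  and oag_to_ovs_mono: "u \<ge> v \<Longrightarrow> oag_to_ovs u \<ge> oag_to_ovs v"
  by (transfer, simp add: ovs_ge_eqI ovs_ge_1I del: ovs_ge.simps)+

lifting_forget ovs.lifting


section \<open>Archimedean regularization\<close>

definition absolutely_convex :: "'v::ordered_rat_vector set \<Rightarrow> bool"
  where "absolutely_convex U \<longleftrightarrow>
    (\<forall>u\<in>U. \<forall>v\<in>U. \<forall>t. 0 \<le> t \<and> t \<le> 1 \<longrightarrow> t *\<^sub>Q u + (1 - t) *\<^sub>Q v \<in> U) \<and> {v. v \<ge> 0} \<subseteq> U"

definition absorbent :: "'v::ordered_rat_vector set \<Rightarrow> bool"
  where "absorbent U \<longleftrightarrow> (\<forall>v. \<exists>\<mu>>0. \<mu> *\<^sub>Q v \<in> U)"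

definition aovs_cone :: "'v::ordered_rat_vector set"
  where "aovs_cone = \<Inter> {U. absolutely_convex U \<and> absorbent U}"

lemma aovs_cone_nonneg: "0 \<le> v \<Longrightarrow> v \<in> aovs_cone"
  by (auto simp: aovs_cone_def absolutely_convex_def)

lemma aovs_cone_scaleQ:
  assumes "v \<in> aovs_cone" "0 \<le> r"
  shows "r *\<^sub>Q v \<in> aovs_cone"
proof (cases "r = 0")
  case True
  then show ?thesis by (simp add: aovs_cone_nonneg)
next
  case False
  with assms have r: "r > 0" by simp
  show ?thesis
    unfolding aovs_cone_def
  proof clarify
    fix U :: "'a set"
    assume U: "absolutely_convex U" "absorbent U"
    let ?W = "{w. r *\<^sub>Q w \<in> U}"
    have "absolutely_convex ?W"
      unfolding absolutely_convex_def
    proof (intro conjI ballI allI impI subsetI CollectI)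
      fix u v t
      assume "u \<in> ?W" "v \<in> ?W" "0 \<le> t \<and> t \<le> (1::rat)"
      then have "t *\<^sub>Q r *\<^sub>Q u + (1 - t) *\<^sub>Q r *\<^sub>Q v \<in> U"
        using U(1) unfolding absolutely_convex_def by blast
      then show "r *\<^sub>Q (t *\<^sub>Q u + (1 - t) *\<^sub>Q v) \<in> U"
        by (simp add: scaleQ_add_right scaleQ_scaleQ mult.commute)
    next
      fix v :: 'a
      assume "v \<in> {v. v \<ge> 0}"
      then have "r *\<^sub>Q v \<ge> 0"
        using scaleQ_left_mono[of r 0 v] r by simp
      then show "r *\<^sub>Q v \<in> U"
        using U(1) unfolding absolutely_convex_def by blast
    qed
    moreover have "absorbent ?W"
      unfolding absorbent_def
    proof
      fix v
      obtain \<mu> where \<mu>: "\<mu> > 0" "\<mu> *\<^sub>Q v \<in> U"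
        using U(2) unfolding absorbent_def by blast
      then show "\<exists>\<mu>>0. \<mu> *\<^sub>Q v \<in> ?W"
        using r by (intro exI[of _ "\<mu> / r"]) (simp add: scaleQ_scaleQ)
    qed
    ultimately show "r *\<^sub>Q v \<in> U"
      using assms(1) unfolding aovs_cone_def by blast
  qed
qed

lemma aovs_cone_add:
  assumes "u \<in> aovs_cone" "v \<in> aovs_cone"
  shows "u + v \<in> aovs_cone"
proof -
  have "(1/2) *\<^sub>Q u + (1 - 1/2) *\<^sub>Q v \<in> aovs_cone"
    unfolding aovs_cone_def
  proof clarify
    fix U :: "'a set"
    assume U: "absolutely_convex U" "absorbent U"
    then have "u \<in> U" "v \<in> U"
      using assms unfolding aovs_cone_def by auto
    moreover have "0 \<le> (1/2::rat) \<and> (1/2::rat) \<le> 1"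
      by simp
    ultimately show "(1/2) *\<^sub>Q u + (1 - 1/2) *\<^sub>Q v \<in> U"
      using U(1) unfolding absolutely_convex_def by blast
  qed
  then have "2 *\<^sub>Q ((1/2) *\<^sub>Q u + (1 - 1/2) *\<^sub>Q v) \<in> aovs_cone"
    by (rule aovs_cone_scaleQ) simp
  then show ?thesis
    by (simp add: scaleQ_add_right scaleQ_scaleQ)
qed

lemma aovs_cone_trans:
  assumes "v - u \<in> aovs_cone" "w - v \<in> aovs_cone"
  shows "w - u \<in> aovs_cone"
  using aovs_cone_add[OF assms(2,1)] by simp

text \<open>Elements ordered both ways by the new cone are identified.\<close>

quotient_type (overloaded) 'v aovs = "'v::ordered_rat_vector" /
  "\<lambda>u v. u - v \<in> aovs_cone \<and> v - u \<in> aovs_cone"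
  by (intro equivpI reflpI sympI transpI) (blast intro: aovs_cone_trans | simp add: aovs_cone_nonneg)+

instantiation aovs :: (ordered_rat_vector) ordered_rat_vector
begin

lift_definition zero_aovs :: "'a aovs" is 0 .

lift_definition plus_aovs :: "'a aovs \<Rightarrow> 'a aovs \<Rightarrow> 'a aovs" is "(+)"
  by (simp add: add_diff_add aovs_cone_add)

lift_definition uminus_aovs :: "'a aovs \<Rightarrow> 'a aovs" is uminus
  by simp

lift_definition minus_aovs :: "'a aovs \<Rightarrow> 'a aovs \<Rightarrow> 'a aovs" is "(-)"
proof clarify
  fix u u' v v' :: 'a
  assume *: "u - u' \<in> aovs_cone" "u' - u \<in> aovs_cone" "v - v' \<in> aovs_cone" "v' - v \<in> aovs_cone"
  show "u - v - (u' - v') \<in> aovs_cone \<and> u' - v' - (u - v) \<in> aovs_cone"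
    using aovs_cone_add[OF *(1,4)] aovs_cone_add[OF *(2,3)] by (simp add: algebra_simps)
qed

lift_definition scaleQ_aovs :: "rat \<Rightarrow> 'a aovs \<Rightarrow> 'a aovs" is "(*\<^sub>Q)"
proof -
  fix q :: rat and u v :: 'a
  assume *: "u - v \<in> aovs_cone \<and> v - u \<in> aovs_cone"
  show "q *\<^sub>Q u - q *\<^sub>Q v \<in> aovs_cone \<and> q *\<^sub>Q v - q *\<^sub>Q u \<in> aovs_cone"
  proof (cases "0 \<le> q")
    case True
    then show ?thesis
      using * unfolding scaleQ_diff_right[symmetric] by (intro conjI aovs_cone_scaleQ) simp_all
  next
    case False
    then have "(- q) *\<^sub>Q (u - v) \<in> aovs_cone" "(- q) *\<^sub>Q (v - u) \<in> aovs_cone"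
      using * by (intro aovs_cone_scaleQ; simp)+
    then show ?thesis
      by (simp add: scaleQ_diff_right scaleQ_minus_left)
  qed
qed

lift_definition less_eq_aovs :: "'a aovs \<Rightarrow> 'a aovs \<Rightarrow> bool" is "\<lambda>u v. v - u \<in> aovs_cone"
proof -
  fix u u' v v' :: 'a
  assume *: "u - u' \<in> aovs_cone \<and> u' - u \<in> aovs_cone" "v - v' \<in> aovs_cone \<and> v' - v \<in> aovs_cone"
  show "v - u \<in> aovs_cone \<longleftrightarrow> v' - u' \<in> aovs_cone"
  proof
    assume "v - u \<in> aovs_cone"
    then have "(v' - v) + (v - u) + (u - u') \<in> aovs_cone"
      using * by (intro aovs_cone_add) auto
    then show "v' - u' \<in> aovs_cone" by simp
  next
    assume "v' - u' \<in> aovs_cone"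
    then have "(v - v') + (v' - u') + (u' - u) \<in> aovs_cone"
      using * by (intro aovs_cone_add) auto
    then show "v - u \<in> aovs_cone" by simp
  qed
qed

definition less_aovs :: "'a aovs \<Rightarrow> 'a aovs \<Rightarrow> bool"
  where "less_aovs u v \<longleftrightarrow> u \<le> v \<and> \<not> v \<le> u"

instance
proof
  fix u v w :: "'a aovs" and p q :: rat
  show "u + v + w = u + (v + w)"
    by transfer (simp add: add.assoc aovs_cone_nonneg)
  show "u + v = v + u"
    by transfer (simp add: add.commute aovs_cone_nonneg)
  show "0 + u = u" "- u + u = 0" "u - v = u + - v"
    by (transfer, simp add: aovs_cone_nonneg)+
  show "u < v \<longleftrightarrow> u \<le> v \<and> \<not> v \<le> u"
    by (rule less_aovs_def)
  show "u \<le> u"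
    by transfer (simp add: aovs_cone_nonneg)
  show "u \<le> v \<Longrightarrow> v \<le> w \<Longrightarrow> u \<le> w"
    by transfer (rule aovs_cone_trans)
  show "u \<le> v \<Longrightarrow> v \<le> u \<Longrightarrow> u = v"
    by transfer simp
  show "u \<le> v \<Longrightarrow> w + u \<le> w + v"
    by transfer simp
  show "q *\<^sub>Q (u + v) = q *\<^sub>Q u + q *\<^sub>Q v"
    by transfer (simp add: scaleQ_add_right aovs_cone_nonneg)
  show "(p + q) *\<^sub>Q u = p *\<^sub>Q u + q *\<^sub>Q u"
    by transfer (simp add: scaleQ_add_left aovs_cone_nonneg)
  show "p *\<^sub>Q q *\<^sub>Q u = (p * q) *\<^sub>Q u"
    by transfer (simp add: scaleQ_scaleQ aovs_cone_nonneg)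
  show "1 *\<^sub>Q u = u"
    by transfer (simp add: aovs_cone_nonneg)
  show "0 \<le> q \<Longrightarrow> u \<le> v \<Longrightarrow> q *\<^sub>Q u \<le> q *\<^sub>Q v"
    by transfer (unfold scaleQ_diff_right[symmetric], rule aovs_cone_scaleQ)
qed

end

lift_definition ovs_to_aovs :: "'v::ordered_rat_vector \<Rightarrow> 'v aovs" is "\<lambda>v. v" .

lemma ovs_to_aovs_zero: "ovs_to_aovs 0 = 0"
  and ovs_to_aovs_add: "ovs_to_aovs (u + v) = ovs_to_aovs u + ovs_to_aovs v"
  and ovs_to_aovs_mono: "u \<ge> v \<Longrightarrow> ovs_to_aovs u \<ge> ovs_to_aovs v"
  and ovs_to_aovs_ge_0_iff: "ovs_to_aovs v \<ge> 0 \<longleftrightarrow> v \<in> aovs_cone"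
  by (transfer, simp add: aovs_cone_nonneg)+


section \<open>The canonical homomorphism\<close>

definition to_aovs :: "'a::ordered_comm_monoid_add \<Rightarrow> 'a ovs aovs"
  where "to_aovs x = ovs_to_aovs (oag_to_ovs (to_oag x))"

lemma to_aovs_zero: "to_aovs 0 = 0"
  and to_aovs_add: "to_aovs (x + y) = to_aovs x + to_aovs y"
  and to_aovs_mono: "x \<ge> y \<Longrightarrow> to_aovs x \<ge> to_aovs y"
  by (simp_all add: to_aovs_def to_oag_zero oag_to_ovs_zero ovs_to_aovs_zero
      to_oag_add oag_to_ovs_add ovs_to_aovs_add to_oag_mono oag_to_ovs_mono ovs_to_aovs_mono)

end

theory Submission
  imports Defs
begin

text \<open>
  Write \<open>V\<close> for the ordered rational vector space of the monoid, \<open>i\<close> for the canonical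
  map into it and \<open>g = i gp - i gm\<close>. The generating pair makes \<open>g\<close> an order unit of \<open>V\<close>
  (\<open>generating_pair_order_unit\<close>), and for an order unit the Archimedean cone has a
  concrete description: \<open>v\<close> belongs to it iff \<open>v + \<epsilon> g \<ge> 0\<close> for all rational
  \<open>\<epsilon> > 0\<close> (\<open>aovs_cone_iff\<close>). The equivalences follow from a cycle of three implications.

  From the regularized order to the approximate order: the inequality
  \<open>i x - i y + \<epsilon> g \<ge> 0\<close> in \<open>V\<close> means an inequality in the monoid up to a multiple and a
  catalyst \<open>z\<close>, of the form \<open>Y + z \<le> X + z\<close>. The catalyst can be used over and over, so
  \<open>N Y + z \<le> N X + z\<close> for all \<open>N\<close>, and both the supply and the disposal of \<open>z\<close> can be
  paid for by a fixed number of copies of the generating pair (\<open>catalyst_removal\<close>). For large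
  \<open>N\<close> this cost is absorbed by the tolerance (\<open>approximate_order_descends\<close>).

  From the approximate order to functionals: applying \<open>f\<close> gives
  \<open>f x - f y \<ge> - (k/n) (f gp - f gm)\<close> with \<open>k/n\<close> arbitrarily small
  (\<open>approximate_order_functional\<close>).

  From functionals to the regularized order: if \<open>v = i x - i y\<close> is outside the Archimedean
  cone, then \<open>v + \<epsilon> g \<ge> 0\<close> fails for some \<open>\<epsilon> > 0\<close>. The gauge of the order unit,
  \<open>v \<mapsto> inf {q. v \<le> q g}\<close>, is a sublinear function with value at least \<open>\<epsilon>\<close> at \<open>- v\<close>.
  By a Hahn-Banach argument there is an additive function below the gauge that attains it at
  \<open>- v\<close>; being below the gauge, it is monotone, and it is negative at \<open>v\<close>
  (\<open>separating_positive_additive\<close>). The Hahn-Banach argument uses that a minimal sublinear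
  function, which exists by Zorn's lemma, is additive (\<open>minimal_sublinear_additive\<close>).
\<close>

section \<open>Sublinear functions on abelian groups\<close>

text \<open>
  The usual notion asks for homogeneity under positive real scalars. On an abelian group
  only natural multiples make sense, and they are enough to find additive functions
  below \<open>p\<close>.
\<close>

definition sublinear :: "('v::ab_group_add \<Rightarrow> real) \<Rightarrow> bool"
  where "sublinear p \<longleftrightarrow>
    (\<forall>u v. p (u + v) \<le> p u + p v) \<and> (\<forall>n v. p (n \<cdot> v) = real n * p v)"

lemma sublinear_add: "sublinear p \<Longrightarrow> p (u + v) \<le> p u + p v"
  and sublinear_nmult: "sublinear p \<Longrightarrow> p (n \<cdot> v) = real n * p v"
  by (simp_all add: sublinear_def)

lemma sublinear_zero: "sublinear p \<Longrightarrow> p 0 = 0"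
  using sublinear_nmult[of p 0 0] by simp

lemma sublinear_ge_minus: "sublinear p \<Longrightarrow> - p (- v) \<le> p v"
  using sublinear_add[of p v "- v"] by (simp add: sublinear_zero)

text \<open>
  Subadditivity yields \<open>p (n v) \<le> n p v\<close> for \<open>n \<ge> 1\<close>, so only the converse
  inequality and the value at \<open>0\<close> have to be checked.
\<close>

lemma sublinearI:
  assumes add: "\<And>u v. p (u + v) \<le> p u + p v"
    and zero: "p 0 \<le> 0"
    and nmult: "\<And>n v. n \<ge> 1 \<Longrightarrow> real n * p v \<le> p (n \<cdot> v)"
  shows "sublinear p"
  unfolding sublinear_def
proof (intro conjI allI)
  show "p (u + v) \<le> p u + p v" for u v
    by (rule add)
  have zero': "p 0 = 0"
    using add[of 0 0] zero by simp
  have le: "p (n \<cdot> v) \<le> real n * p v" for n v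
  proof (induction n)
    case (Suc n)
    then show ?case
      using add[of v "n \<cdot> v"] by (simp add: nmult_Suc distrib_right)
  qed (simp add: zero')
  show "p (n \<cdot> v) = real n * p v" for n v
    using le[of n v] nmult[of n v] zero' by (cases "n = 0") auto
qed

text \<open>
  An infimum of sublinear functions is in general not subadditive; along a chain it
  is. The values cannot escape to \<open>-\<infinity>\<close>, because every member satisfies
  \<open>f v \<ge> - f (- v) \<ge> - p (- v)\<close>.
\<close>

lemma sublinear_INF_chain:
  assumes C: "C \<noteq> {}" "\<And>f. f \<in> C \<Longrightarrow> sublinear f"
    and chain: "\<And>f h. f \<in> C \<Longrightarrow> h \<in> C \<Longrightarrow> f \<le> h \<or> h \<le> f"
    and le: "\<And>f. f \<in> C \<Longrightarrow> f \<le> p"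
  defines "q \<equiv> \<lambda>v. INF f\<in>C. f v"
  shows "sublinear q" and "\<And>f v. f \<in> C \<Longrightarrow> q v \<le> f v"
proof -
  have "bdd_below ((\<lambda>f. f v) ` C)" for v
  proof (rule bdd_belowI2)
    fix f assume "f \<in> C"
    then show "- p (- v) \<le> f v"
      using sublinear_ge_minus[OF C(2), of f v] le_funD[OF le, of f "- v"] by linarith
  qed
  then show lower: "q v \<le> f v" if "f \<in> C" for f v
    unfolding q_def using that by (intro cINF_lower)
  have greatest: "c \<le> q v" if "\<And>f. f \<in> C \<Longrightarrow> c \<le> f v" for c v
    unfolding q_def using C(1) that by (rule cINF_greatest)
  show "sublinear q"
  proof (rule sublinearI)
    fix u v
    have *: "q (u + v) \<le> f u + h v" if fh: "f \<in> C" "h \<in> C" for f h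
    proof -
      \<comment> \<open>The smaller of the two members of the chain witnesses both summands.\<close>
      obtain e where e: "e \<in> C" "e \<le> f" "e \<le> h"
        using chain[OF fh] fh by blast
      have "q (u + v) \<le> e u + e v"
        using lower[OF e(1)] sublinear_add[OF C(2)[OF e(1)]] order_trans by blast
      also have "\<dots> \<le> f u + h v"
        using e by (intro add_mono) (simp_all add: le_fun_def)
      finally show ?thesis .
    qed
    have "q (u + v) - h v \<le> q u" if "h \<in> C" for h
      using * that by (intro greatest) (simp add: diff_le_eq)
    then have "q (u + v) - q u \<le> q v"
      by (intro greatest) (simp add: diff_le_eq add.commute)
    then show "q (u + v) \<le> q u + q v" by simp
  next
    obtain f where f: "f \<in> C" using C(1) by blast
    show "q 0 \<le> 0"
      using lower[OF f, of 0] sublinear_zero[OF C(2)[OF f]] by simp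
  next
    fix n :: nat and v
    show "real n * q v \<le> q (n \<cdot> v)"
      using lower by (intro greatest) (simp add: sublinear_nmult[OF C(2)] mult_left_mono)
  qed
qed

text \<open>
  Any additive \<open>f \<le> p\<close> with \<open>f w = p w\<close> satisfies \<open>f v \<le> p (v + n w) - n p w\<close>
  for all \<open>n\<close>. The tilt of \<open>p\<close> is the best upper bound that arises in this way; it
  builds the wish \<open>f w = p w\<close> into the sublinear function.
\<close>

definition tilt :: "('v::ab_group_add \<Rightarrow> real) \<Rightarrow> 'v \<Rightarrow> 'v \<Rightarrow> real"
  where "tilt p w v = (INF n. p (v + n \<cdot> w) - real n * p w)"

lemma
  assumes p: "sublinear p"
  shows tilt_lower: "tilt p w v \<le> p (v + n \<cdot> w) - real n * p w"
    and sublinear_tilt: "sublinear (tilt p w)"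
proof -
  have "bdd_below (range (\<lambda>n. p (v + n \<cdot> w) - real n * p w))" for v
  proof (rule bdd_belowI2)
    fix n
    have "p (n \<cdot> w) \<le> p (v + n \<cdot> w) + p (- v)"
      using sublinear_add[OF p, of "v + n \<cdot> w" "- v"] by simp
    then show "- p (- v) \<le> p (v + n \<cdot> w) - real n * p w"
      by (simp add: sublinear_nmult[OF p])
  qed
  then show lower: "tilt p w v \<le> p (v + n \<cdot> w) - real n * p w" for n v
    unfolding tilt_def by (intro cINF_lower) auto
  have greatest: "c \<le> tilt p w v" if "\<And>n. c \<le> p (v + n \<cdot> w) - real n * p w" for c v
    unfolding tilt_def using that by (intro cINF_greatest) auto
  show "sublinear (tilt p w)"
  proof (rule sublinearI)
    fix u v
    have *: "tilt p w (u + v) \<le> (p (u + m \<cdot> w) - real m * p w) + (p (v + n \<cdot> w) - real n * p w)" for m n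
      using lower[of "u + v" "m + n"] sublinear_add[OF p, of "u + m \<cdot> w" "v + n \<cdot> w"]
      by (simp add: nmult_add_left algebra_simps)
    have "tilt p w (u + v) - (p (v + n \<cdot> w) - real n * p w) \<le> tilt p w u" for n
      using *[of _ n] by (intro greatest) (simp add: diff_le_eq)
    then have "tilt p w (u + v) - tilt p w u \<le> tilt p w v"
      by (intro greatest) (simp add: algebra_simps)
    then show "tilt p w (u + v) \<le> tilt p w u + tilt p w v" by simp
  next
    show "tilt p w 0 \<le> 0"
      using lower[of 0 0] by (simp add: sublinear_zero[OF p])
  next
    fix m :: nat and v assume "m \<ge> 1"
    then obtain l where l: "m = Suc l" by (cases m) auto
    show "real m * tilt p w v \<le> tilt p w (m \<cdot> v)"
    proof (rule greatest)
      fix n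
      \<comment> \<open>Enlarging the number of copies of \<open>w\<close> from \<open>n\<close> to \<open>m n\<close> makes \<open>m\<close> a common factor.\<close>
      have "real m * tilt p w v \<le> real m * (p (v + n \<cdot> w) - real n * p w)"
        using lower by (intro mult_left_mono) simp_all
      also have "\<dots> = p (m \<cdot> v + n \<cdot> w + (l * n) \<cdot> w) - real (m * n) * p w"
      proof -
        have "m \<cdot> v + n \<cdot> w + (l * n) \<cdot> w = m \<cdot> (v + n \<cdot> w)"
          by (simp add: l nmult_add_right nmult_nmult nmult_add_left add.assoc)
        then show ?thesis
          by (simp add: sublinear_nmult[OF p] algebra_simps)
      qed
      also have "\<dots> \<le> p (m \<cdot> v + n \<cdot> w) - real n * p w"
        using sublinear_add[OF p, of "m \<cdot> v + n \<cdot> w" "(l * n) \<cdot> w"]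
        by (simp add: sublinear_nmult[OF p] l algebra_simps)
      finally show "real m * tilt p w v \<le> p (m \<cdot> v + n \<cdot> w) - real n * p w" .
    qed
  qed
qed

lemma tilt_le: "sublinear p \<Longrightarrow> tilt p w v \<le> p v"
  using tilt_lower[of p w v 0] by simp

text \<open>
  By minimality \<open>p\<close> coincides with its own tilt in the direction \<open>w\<close>, and the term
  \<open>n = 1\<close> of the tilt then says that \<open>p\<close> is superadditive.
\<close>

lemma minimal_sublinear_additive:
  assumes p: "sublinear p" and min: "\<And>q. sublinear q \<Longrightarrow> q \<le> p \<Longrightarrow> q = p"
  shows "p (v + w) = p v + p w"
proof -
  have "tilt p w = p"
    using p by (intro min sublinear_tilt) (auto simp: le_fun_def tilt_le)
  then have "p v \<le> p (v + w) - p w"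
    using tilt_lower[OF p, of w v 1] by simp
  then show ?thesis
    using sublinear_add[OF p, of v w] by simp
qed

lemma ex_minimal_sublinear:
  assumes p: "sublinear p"
  obtains q where "sublinear q" "q \<le> p" "\<And>r. sublinear r \<Longrightarrow> r \<le> q \<Longrightarrow> r = q"
proof -
  define S where "S = {q. sublinear q \<and> q \<le> p}"
  have "\<exists>q\<in>S. \<forall>r\<in>S. q \<ge> r \<longrightarrow> r = q"
  proof (rule predicate_Zorn)
    show "partial_order_on S (relation_of (\<ge>) S)"
      by (rule partial_order_on_relation_ofI) auto
  next
    fix C assume "C \<in> Chains (relation_of (\<ge>) S)"
    then have C: "C \<subseteq> S" "\<And>f h. f \<in> C \<Longrightarrow> h \<in> C \<Longrightarrow> f \<le> h \<or> h \<le> f"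
      unfolding Chains_def relation_of_def by auto
    show "\<exists>q\<in>S. \<forall>f\<in>C. f \<ge> q"
    proof (cases "C = {}")
      case True
      then show ?thesis using p by (auto simp: S_def)
    next
      case False
      let ?q = "\<lambda>v. INF f\<in>C. f v"
      have CS: "sublinear f" "f \<le> p" if "f \<in> C" for f
        using that C(1) by (auto simp: S_def)
      note inf = sublinear_INF_chain[where p = p, OF False CS(1) C(2) CS(2)]
      obtain f where "f \<in> C" using False by blast
      then have "?q \<le> f" "f \<le> p"
        using inf(2) CS(2) by (simp_all add: le_fun_def)
      then have "?q \<le> p" by (rule order_trans)
      with inf have "?q \<in> S" "\<forall>f\<in>C. f \<ge> ?q"
        by (auto simp: S_def le_fun_def)
      then show ?thesis by blast
    qed
  qed
  then show thesis
    using that by (auto simp: S_def intro: order_trans)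
qed

text \<open>
  A form of the Hahn-Banach theorem. Below the tilt of \<open>p\<close> in the direction \<open>w\<close> there
  is a minimal sublinear, hence additive, function \<open>f\<close>. The tilt takes a value of at
  most \<open>- p w\<close> at \<open>- w\<close>, which forces \<open>f w \<ge> p w\<close>.
\<close>

theorem sublinear_attained_by_additive:
  assumes p: "sublinear p"
  obtains f where "\<And>u v. f (u + v) = f u + f v" "\<And>v. f v \<le> p v" "f w = p w"
proof -
  obtain f where f: "sublinear f" "f \<le> tilt p w" "\<And>r. sublinear r \<Longrightarrow> r \<le> f \<Longrightarrow> r = f"
    using ex_minimal_sublinear[OF sublinear_tilt[OF p]] by blast
  have add: "f (u + v) = f u + f v" for u v
    using f(1,3) by (rule minimal_sublinear_additive)
  have le: "f v \<le> p v" for v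
    using f(2) tilt_le[OF p] by (auto simp: le_fun_def intro: order_trans)
  have "f (- w) \<le> - p w"
    using f(2) tilt_lower[OF p, of w "- w" 1] sublinear_zero[OF p]
    by (auto simp: le_fun_def intro: order_trans)
  moreover have "f (- w) = - f w"
    using add[of w "- w"] sublinear_zero[OF f(1)] by simp
  ultimately have "f w = p w"
    using le[of w] by simp
  with add le show thesis by (rule that)
qed

section \<open>Order units and the Archimedean cone\<close>

definition order_unit :: "'v::ordered_rat_vector \<Rightarrow> bool"
  where "order_unit g \<longleftrightarrow> g \<ge> 0 \<and> (\<forall>v. \<exists>q. v \<le> q *\<^sub>Q g)"

lemma scaleQ_right_mono:
  fixes g :: "'v::ordered_rat_vector"
  assumes "p \<le> q" "0 \<le> g"
  shows "p *\<^sub>Q g \<le> q *\<^sub>Q g"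
proof -
  have "0 \<le> (q - p) *\<^sub>Q g"
    using scaleQ_left_mono[of "q - p" 0 g] assms by simp
  then have "p *\<^sub>Q g + 0 \<le> p *\<^sub>Q g + (q - p) *\<^sub>Q g"
    by (rule add_left_mono)
  then show ?thesis
    by (simp flip: scaleQ_add_left)
qed

lemma nmult_eq_scaleQ: "n \<cdot> v = of_nat n *\<^sub>Q (v::'v::ordered_rat_vector)"
  by (induction n) (simp_all add: nmult_Suc scaleQ_add_left)

text \<open>
  For an order unit \<open>g\<close>, each shifted cone \<open>{u. 0 \<le> u + \<epsilon> g}\<close> is itself absolutely
  convex and absorbent, so the Archimedean cone lies in their intersection.
  Conversely an arbitrary absolutely convex absorbent set contains some
  \<open>\<mu> (v - g)\<close>, and \<open>v\<close> is a convex combination of this point with a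
  nonnegative element.
\<close>

lemma aovs_cone_iff:
  fixes g v :: "'v::ordered_rat_vector"
  assumes g: "order_unit g"
  shows "v \<in> aovs_cone \<longleftrightarrow> (\<forall>\<epsilon>>0. 0 \<le> v + \<epsilon> *\<^sub>Q g)"
proof (intro iffI allI impI)
  fix \<epsilon> :: rat
  assume v: "v \<in> aovs_cone" and \<epsilon>: "\<epsilon> > 0"
  let ?U = "{u. 0 \<le> u + \<epsilon> *\<^sub>Q g}"
  have g0: "0 \<le> \<epsilon> *\<^sub>Q g"
    using g \<epsilon> scaleQ_left_mono[of \<epsilon> 0 g] by (simp add: order_unit_def)
  have "absolutely_convex ?U"
    unfolding absolutely_convex_def
  proof (intro conjI ballI allI impI subsetI CollectI)
    fix u w and t :: rat
    assume "u \<in> ?U" "w \<in> ?U" "0 \<le> t \<and> t \<le> 1"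
    then have "0 \<le> t *\<^sub>Q (u + \<epsilon> *\<^sub>Q g) + (1 - t) *\<^sub>Q (w + \<epsilon> *\<^sub>Q g)"
      using scaleQ_left_mono[of t 0] scaleQ_left_mono[of "1 - t" 0] by (intro add_nonneg_nonneg) auto
    also have "\<dots> = t *\<^sub>Q u + (1 - t) *\<^sub>Q w + (t *\<^sub>Q \<epsilon> *\<^sub>Q g + (1 - t) *\<^sub>Q \<epsilon> *\<^sub>Q g)"
      by (simp add: scaleQ_add_right ac_simps)
    finally show "0 \<le> t *\<^sub>Q u + (1 - t) *\<^sub>Q w + \<epsilon> *\<^sub>Q g"
      by (simp flip: scaleQ_add_left)
  qed (use g0 in auto)
  moreover have "absorbent ?U"
    unfolding absorbent_def
  proof
    fix w :: 'v
    obtain q where q: "- w \<le> q *\<^sub>Q g"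
      using g unfolding order_unit_def by blast
    define r where "r = max q 1"
    have r: "r > 0" and "- w \<le> r *\<^sub>Q g"
      using q scaleQ_right_mono[of q r g] g by (auto simp: r_def order_unit_def intro: order_trans)
    then have "(\<epsilon> / r) *\<^sub>Q (- w) \<le> (\<epsilon> / r) *\<^sub>Q r *\<^sub>Q g"
      using \<epsilon> by (intro scaleQ_left_mono) simp_all
    then have "- ((\<epsilon> / r) *\<^sub>Q w) \<le> \<epsilon> *\<^sub>Q g"
      using r by (simp add: scaleQ_scaleQ scaleQ_minus_right)
    then have "0 \<le> (\<epsilon> / r) *\<^sub>Q w + \<epsilon> *\<^sub>Q g"
      using add_left_mono[of "- ((\<epsilon> / r) *\<^sub>Q w)" "\<epsilon> *\<^sub>Q g" "(\<epsilon> / r) *\<^sub>Q w"] by simp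
    then show "\<exists>\<mu>>0. \<mu> *\<^sub>Q w \<in> ?U"
      using \<epsilon> r by (intro exI[of _ "\<epsilon> / r"]) simp
  qed
  ultimately show "0 \<le> v + \<epsilon> *\<^sub>Q g"
    using v by (auto simp: aovs_cone_def)
next
  assume pos: "\<forall>\<epsilon>>0. 0 \<le> v + \<epsilon> *\<^sub>Q g"
  show "v \<in> aovs_cone"
    unfolding aovs_cone_def
  proof clarify
    fix U :: "'v set"
    assume U: "absolutely_convex U" "absorbent U"
    obtain \<mu> where \<mu>: "\<mu> > 0" "\<mu> *\<^sub>Q (v - g) \<in> U"
      using U(2) unfolding absorbent_def by blast
    define t where "t = 1 / (1 + \<mu>)"
    \<comment> \<open>Solve \<open>v = t \<mu> (v - g) + (1 - t) a\<close> for \<open>a\<close> when \<open>t = 1 / (1 + \<mu>)\<close>.\<close>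
    define a where "a = (1 / \<mu>) *\<^sub>Q (v + \<mu> *\<^sub>Q g)"
    have t: "0 \<le> t" "t \<le> 1" "t * \<mu> = 1 - t" "(1 - t) * (1 / \<mu>) = t"
      using \<mu> by (simp_all add: t_def field_simps)
    have "0 \<le> a"
      using pos \<mu> scaleQ_left_mono[of "1 / \<mu>" 0 "v + \<mu> *\<^sub>Q g"] by (simp add: a_def)
    then have "a \<in> U"
      using U(1) by (auto simp: absolutely_convex_def)
    with \<mu>(2) t have "t *\<^sub>Q \<mu> *\<^sub>Q (v - g) + (1 - t) *\<^sub>Q a \<in> U"
      using U(1) unfolding absolutely_convex_def by blast
    also have "(1 - t) *\<^sub>Q a = t *\<^sub>Q v + (1 - t) *\<^sub>Q g"
      using \<mu>(1) by (simp only: a_def scaleQ_add_right scaleQ_scaleQ t(4) mult.assoc[symmetric])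
        (simp add: t(3))
    also have "t *\<^sub>Q \<mu> *\<^sub>Q (v - g) = (1 - t) *\<^sub>Q v - (1 - t) *\<^sub>Q g"
      by (simp only: scaleQ_scaleQ t(3) scaleQ_diff_right)
    also have "\<dots> + (t *\<^sub>Q v + (1 - t) *\<^sub>Q g) = v"
      by (simp add: ac_simps flip: scaleQ_add_left)
    finally show "v \<in> U" .
  qed
qed

text \<open>
  A one-sided version of the order seminorm of \<open>g\<close>: only the upper bound \<open>v \<le> q g\<close>
  counts, so for an order unit that is not \<open>\<le> 0\<close> the elements \<open>v \<le> 0\<close> have a value of
  at most \<open>0\<close>. This makes the additive functions below the gauge monotone.
\<close>

definition gauge :: "'v::ordered_rat_vector \<Rightarrow> 'v \<Rightarrow> real"
  where "gauge g v = Inf (of_rat ` {q. v \<le> q *\<^sub>Q g})"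

lemma scaleQ_le_cancel:
  fixes g :: "'v::ordered_rat_vector"
  assumes ng: "\<not> g \<le> 0" and "p *\<^sub>Q g \<le> q *\<^sub>Q g"
  shows "p \<le> q"
proof (rule ccontr)
  assume "\<not> p \<le> q"
  then have "(1 / (p - q)) *\<^sub>Q p *\<^sub>Q g - (1 / (p - q)) *\<^sub>Q q *\<^sub>Q g \<le> 0"
    using assms by (simp add: scaleQ_left_mono)
  also have "(1 / (p - q)) *\<^sub>Q p *\<^sub>Q g - (1 / (p - q)) *\<^sub>Q q *\<^sub>Q g = (1 / (p - q)) *\<^sub>Q (p - q) *\<^sub>Q g"
    by (simp only: module.scale_left_diff_distrib[OF module_scaleQ] scaleQ_diff_right)
  also have "\<dots> = g"
    using \<open>\<not> p \<le> q\<close> by (simp add: scaleQ_scaleQ)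
  finally show False using ng by simp
qed

text \<open>
  The set defining the gauge is bounded below because \<open>v\<close> lies above some
  \<open>- m g\<close>; this is where \<open>g\<close> must not be \<open>\<le> 0\<close>, as otherwise every rational
  would qualify. The two facts characterize the gauge as an infimum.
\<close>

lemma
  fixes g :: "'v::ordered_rat_vector"
  assumes g: "order_unit g" "\<not> g \<le> 0"
  shows gauge_le: "v \<le> q *\<^sub>Q g \<Longrightarrow> gauge g v \<le> of_rat q"
    and gauge_greatest: "(\<And>q. v \<le> q *\<^sub>Q g \<Longrightarrow> c \<le> of_rat q) \<Longrightarrow> c \<le> gauge g v"
proof -
  obtain m where "- v \<le> m *\<^sub>Q g"
    using g(1) unfolding order_unit_def by blast
  then have m: "(- m) *\<^sub>Q g \<le> v"
    by (simp add: scaleQ_minus_left minus_le_iff)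
  have "bdd_below (real_of_rat ` {q. v \<le> q *\<^sub>Q g})"
  proof (rule bdd_belowI2)
    fix q assume "q \<in> {q. v \<le> q *\<^sub>Q g}"
    with m have "- m \<le> q"
      using g(2) scaleQ_le_cancel order_trans by blast
    then show "of_rat (- m) \<le> real_of_rat q"
      by (simp only: of_rat_less_eq)
  qed
  then show "v \<le> q *\<^sub>Q g \<Longrightarrow> gauge g v \<le> of_rat q"
    unfolding gauge_def by (intro cInf_lower) auto
  show "(\<And>q. v \<le> q *\<^sub>Q g \<Longrightarrow> c \<le> of_rat q) \<Longrightarrow> c \<le> gauge g v"
    unfolding gauge_def using g(1) by (intro cInf_greatest) (auto simp: order_unit_def)
qed

lemma sublinear_gauge:
  fixes g :: "'v::ordered_rat_vector"
  assumes g: "order_unit g" "\<not> g \<le> 0"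
  shows "sublinear (gauge g)"
proof (rule sublinearI)
  fix u v :: 'v
  have "gauge g (u + v) \<le> of_rat p + of_rat q" if "u \<le> p *\<^sub>Q g" "v \<le> q *\<^sub>Q g" for p q
    using gauge_le[OF g, of "u + v" "p + q"] add_mono[OF that]
    by (simp add: scaleQ_add_left of_rat_add)
  then have "gauge g (u + v) - of_rat q \<le> gauge g u" if "v \<le> q *\<^sub>Q g" for q
    using that by (intro gauge_greatest[OF g]) (simp add: diff_le_eq)
  then have "gauge g (u + v) - gauge g u \<le> gauge g v"
    by (intro gauge_greatest[OF g]) (simp add: diff_le_eq add.commute)
  then show "gauge g (u + v) \<le> gauge g u + gauge g v" by simp
next
  show "gauge g 0 \<le> 0"
    using gauge_le[OF g, of 0 0] by simp
next
  fix n :: nat and v :: 'v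
  assume n: "n \<ge> 1"
  show "real n * gauge g v \<le> gauge g (n \<cdot> v)"
  proof (rule gauge_greatest[OF g])
    fix q assume "n \<cdot> v \<le> q *\<^sub>Q g"
    then have "(1 / of_nat n) *\<^sub>Q n \<cdot> v \<le> (1 / of_nat n) *\<^sub>Q q *\<^sub>Q g"
      by (intro scaleQ_left_mono) simp_all
    then have "gauge g v \<le> of_rat (q / of_nat n)"
      using n by (intro gauge_le[OF g]) (simp add: nmult_eq_scaleQ scaleQ_scaleQ)
    then show "real n * gauge g v \<le> of_rat q"
      using n by (simp add: of_rat_divide field_simps)
  qed
qed

text \<open>
  If \<open>v + \<epsilon> g\<close> is not positive, then the gauge of \<open>- v\<close> is at least \<open>\<epsilon>\<close>, and
  the additive function that attains the gauge at \<open>- v\<close> separates \<open>v\<close> from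
  the cone.
\<close>

lemma separating_positive_additive:
  fixes g v :: "'v::ordered_rat_vector"
  assumes g: "order_unit g" and v: "v \<notin> aovs_cone"
  obtains f :: "'v \<Rightarrow> real"
    where "\<And>u w. f (u + w) = f u + f w" "\<And>u. 0 \<le> u \<Longrightarrow> 0 \<le> f u" "f v < 0"
proof -
  obtain \<epsilon> where \<epsilon>: "\<epsilon> > 0" "\<not> 0 \<le> v + \<epsilon> *\<^sub>Q g"
    using v by (auto simp: aovs_cone_iff[OF g])
  have g0: "0 \<le> g"
    using g by (simp add: order_unit_def)
  have ng: "\<not> g \<le> 0"
  proof
    \<comment> \<open>Otherwise \<open>g = 0\<close>, so every element would be at most \<open>0\<close>.\<close>
    assume "g \<le> 0"
    with g0 have "g = 0" by simp
    moreover obtain q where "- v \<le> q *\<^sub>Q g"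
      using g unfolding order_unit_def by blast
    ultimately show False
      using \<epsilon>(2) by simp
  qed
  obtain f where add: "\<And>u w. f (u + w) = f u + f w"
    and le: "\<And>u. f u \<le> gauge g u" and eq: "f (- v) = gauge g (- v)"
    using sublinear_attained_by_additive[OF sublinear_gauge[OF g ng], of "- v"] by blast
  have minus: "f (- u) = - f u" for u
    using add[of u "- u"] add[of 0 0] by simp
  have "of_rat \<epsilon> \<le> gauge g (- v)"
  proof (rule gauge_greatest[OF g ng])
    fix q assume q: "- v \<le> q *\<^sub>Q g"
    have "\<not> q \<le> \<epsilon>"
    proof
      assume "q \<le> \<epsilon>"
      then have "- v \<le> \<epsilon> *\<^sub>Q g"
        using q scaleQ_right_mono[OF _ g0] order_trans by blast
      then show False
        using \<epsilon>(2) add_left_mono[of "- v" "\<epsilon> *\<^sub>Q g" v] by simp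
    qed
    then show "real_of_rat \<epsilon> \<le> of_rat q"
      by (simp add: of_rat_less_eq)
  qed
  then have "f v < 0"
    using \<epsilon>(1) eq minus[of v] zero_less_of_rat_iff[of \<epsilon>, where 'a = real] by linarith
  moreover have "0 \<le> f u" if "0 \<le> u" for u
    using le[of "- u"] gauge_le[OF g ng, of "- u" 0] minus[of u] that by simp
  ultimately show thesis
    using add that by blast
qed

section \<open>The ordered rational vector space of a monoid\<close>

definition to_ovs :: "'a::ordered_comm_monoid_add \<Rightarrow> 'a ovs"
  where "to_ovs x = oag_to_ovs (to_oag x)"

lemma to_ovs_zero: "to_ovs 0 = 0"
  and to_ovs_add: "to_ovs (x + y) = to_ovs x + to_ovs y"
  and to_ovs_mono: "x \<le> y \<Longrightarrow> to_ovs x \<le> to_ovs y"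
  by (simp_all add: to_ovs_def to_oag_zero oag_to_ovs_zero to_oag_add oag_to_ovs_add
      to_oag_mono oag_to_ovs_mono)

lemma to_aovs_le_iff: "to_aovs y \<le> to_aovs x \<longleftrightarrow> to_ovs x - to_ovs y \<in> aovs_cone"
  by (simp add: to_aovs_def to_ovs_def ovs_to_aovs.abs_eq less_eq_aovs.abs_eq)

lemma nmult_hom:
  assumes "f 0 = 0" "\<And>x y. f (x + y) = f x + f y"
  shows "f (n \<cdot> x) = n \<cdot> f x"
  by (induction n) (simp_all add: assms nmult_Suc)

lemmas to_ovs_nmult = nmult_hom[of to_ovs, OF to_ovs_zero to_ovs_add]
lemmas to_oag_nmult = nmult_hom[of to_oag, OF to_oag_zero to_oag_add]
lemmas oag_to_ovs_nmult = nmult_hom[of oag_to_ovs, OF oag_to_ovs_zero oag_to_ovs_add]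

lemma to_oag_le_iff: "to_oag y \<le> to_oag x \<longleftrightarrow> (\<exists>z. y + z \<le> x + z)"
  by (simp add: to_oag.abs_eq less_eq_oag.abs_eq)

lemma oag_to_ovs_le_iff: "oag_to_ovs v \<le> oag_to_ovs u \<longleftrightarrow> (\<exists>j\<ge>1. j \<cdot> v \<le> j \<cdot> u)"
  by (simp add: oag_to_ovs.abs_eq less_eq_ovs.abs_eq ovs_ge_refl del: ovs_ge.simps)
    simp

lemma to_ovs_le_iff:
  "to_ovs y \<le> to_ovs x \<longleftrightarrow> (\<exists>j\<ge>1. \<exists>z. j \<cdot> y + z \<le> j \<cdot> x + z)"
  by (simp add: to_ovs_def oag_to_ovs_le_iff to_oag_le_iff flip: to_oag_nmult)

lemma oag_eq_diff: obtains a b where "u = to_oag a - to_oag b"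
proof (induction u rule: oag.abs_induct)
  case (1 p)
  have "to_oag (fst p) - to_oag (snd p) = abs_oag p"
    by (cases p) (simp add: minus_oag_def to_oag.abs_eq uminus_oag.abs_eq plus_oag.abs_eq)
  then show ?case using 1 by metis
qed

text \<open>
  A fraction \<open>1/n u\<close> with \<open>u \<le> m h\<close> satisfies \<open>1/n u \<le> m h\<close> as well, since
  \<open>m h \<le> n m h\<close>. So a positive element that dominates the group of differences also
  dominates its rational vector space.
\<close>

lemma ovs_le_oag:
  assumes "\<And>u. \<exists>m::nat. u \<le> m \<cdot> (h::'a::ordered_comm_monoid_add oag)" "0 \<le> h"
  shows "\<exists>m::nat. v \<le> m \<cdot> oag_to_ovs h"
proof (induction v rule: ovs.abs_induct)
  case (1 p)
  then obtain n u where p: "p = (n, u)" "n \<ge> 1"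
    by (cases p) auto
  obtain m where m: "u \<le> m \<cdot> h"
    using assms(1) by blast
  have "0 \<le> m \<cdot> h"
    using nmult_mono[OF assms(2), of m] by simp
  moreover obtain n' where "n = Suc n'"
    using p by (cases n) auto
  ultimately have "u \<le> n \<cdot> m \<cdot> h"
    using m nmult_mono[of 0 "m \<cdot> h" n'] add_mono[of u "m \<cdot> h" 0 "n' \<cdot> m \<cdot> h"]
    by (simp add: nmult_Suc)
  then have "ovs_ge (1, m \<cdot> h) (n, u)"
    by (auto intro!: exI[of _ 1])
  then have "abs_ovs p \<le> oag_to_ovs (m \<cdot> h)"
    using p by (simp add: oag_to_ovs.abs_eq less_eq_ovs.abs_eq ovs_ge_refl del: ovs_ge.simps)
  then show ?case
    by (auto simp: oag_to_ovs_nmult)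
qed

text \<open>
  The two inequalities for a generating pair bound \<open>a\<close> and \<open>- b\<close> separately by
  multiples of \<open>gp - gm\<close>; adding them bounds every formal difference \<open>a - b\<close>.
\<close>

lemma generating_pair_order_unit:
  assumes gen: "generating_pair gp gm"
  shows "order_unit (to_ovs gp - to_ovs gm)"
proof -
  let ?h = "to_oag gp - to_oag gm"
  have "\<exists>m::nat. u \<le> m \<cdot> ?h" for u
  proof -
    obtain a b where u: "u = to_oag a - to_oag b"
      by (rule oag_eq_diff)
    obtain k l :: nat where "a + k \<cdot> gm \<le> k \<cdot> gp" "l \<cdot> gm \<le> l \<cdot> gp + b"
      using gen unfolding generating_pair_def by metis
    then have "to_oag (a + k \<cdot> gm) + to_oag (l \<cdot> gm) \<le> to_oag (k \<cdot> gp) + to_oag (l \<cdot> gp + b)"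
      by (intro add_mono to_oag_mono)
    then have "u \<le> (k + l) \<cdot> to_oag gp - (k + l) \<cdot> to_oag gm"
      by (simp add: u to_oag_add to_oag_nmult nmult_add_left algebra_simps)
    also have "\<dots> = (k + l) \<cdot> ?h"
      using nmult_add_right[of "k + l" "to_oag gp" "- to_oag gm"] by (simp add: nmult_minus)
    finally show ?thesis by blast
  qed
  moreover have "0 \<le> ?h"
    using gen by (simp add: generating_pair_def to_oag_mono)
  ultimately have bound: "\<exists>m::nat. v \<le> m \<cdot> oag_to_ovs ?h" for v
    by (rule ovs_le_oag)
  have h: "oag_to_ovs ?h = to_ovs gp - to_ovs gm"
    using oag_to_ovs_add[of ?h "to_oag gm"] by (simp add: to_ovs_def eq_diff_eq)
  have "to_ovs gm \<le> to_ovs gp"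
    using gen by (simp add: generating_pair_def to_ovs_mono)
  then show ?thesis
    using bound unfolding order_unit_def h nmult_eq_scaleQ by auto
qed

lemma to_ovs_clear_denominator:
  assumes n: "n \<ge> 1"
    and le: "0 \<le> (to_ovs x - to_ovs y) + (1 / of_nat n) *\<^sub>Q (to_ovs gp - to_ovs gm)"
      (is "0 \<le> ?w")
  shows "to_ovs (n \<cdot> y + gm) \<le> to_ovs (n \<cdot> x + gp)"
proof -
  have "0 \<le> of_nat n *\<^sub>Q ?w"
    using scaleQ_left_mono[of "of_nat n" 0 ?w] le by simp
  also have "\<dots> = to_ovs (n \<cdot> x + gp) - to_ovs (n \<cdot> y + gm)"
    using n by (simp add: to_ovs_add to_ovs_nmult nmult_eq_scaleQ scaleQ_add_right
        scaleQ_scaleQ scaleQ_diff_right)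
  finally show ?thesis by simp
qed

section \<open>The approximate order of a monoid\<close>

text \<open>
  The same catalyst \<open>z\<close> serves for any number of copies: it is handed on from one
  conversion to the next.
\<close>

lemma catalyst_nmult:
  fixes X Y z :: "'a::ordered_comm_monoid_add"
  assumes "Y + z \<le> X + z"
  shows "N \<cdot> Y + z \<le> N \<cdot> X + z"
proof (induction N)
  case (Suc N)
  have "Suc N \<cdot> Y + z = Y + (N \<cdot> Y + z)"
    by (simp add: nmult_Suc add.assoc)
  also have "\<dots> \<le> Y + (N \<cdot> X + z)"
    using Suc by (rule add_left_mono)
  also have "\<dots> = N \<cdot> X + (Y + z)"
    by (simp add: ac_simps)
  also have "\<dots> \<le> N \<cdot> X + (X + z)"
    using assms by (rule add_left_mono)
  also have "\<dots> = Suc N \<cdot> X + z"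
    by (simp add: nmult_Suc ac_simps)
  finally show ?case .
qed simp

text \<open>
  The catalyst is traded for copies of the generating pair: its creation at the start and
  its disposal at the end each turn \<open>l\<close> copies of \<open>gp\<close> into \<open>l\<close> copies of \<open>gm\<close>. What
  matters is that the price \<open>m = 2 l\<close> is independent of the number \<open>N\<close> of conversions.
\<close>

lemma catalyst_removal:
  assumes gen: "generating_pair gp gm" and z: "Y + z \<le> X + z"
  obtains m :: nat where "\<And>N. N \<cdot> Y + m \<cdot> gm \<le> N \<cdot> X + m \<cdot> gp"
proof -
  obtain l :: nat where l: "z + l \<cdot> gm \<le> l \<cdot> gp" "l \<cdot> gm \<le> l \<cdot> gp + z"
    using gen unfolding generating_pair_def by blast
  have "N \<cdot> Y + (l + l) \<cdot> gm \<le> N \<cdot> X + (l + l) \<cdot> gp" for N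
  proof -
    have "N \<cdot> Y + (l + l) \<cdot> gm = N \<cdot> Y + l \<cdot> gm + l \<cdot> gm"
      by (simp add: nmult_add_left add.assoc)
    also have "\<dots> \<le> N \<cdot> Y + l \<cdot> gm + (l \<cdot> gp + z)"
      using l(2) by (rule add_left_mono)
    also have "\<dots> = (l \<cdot> gm + l \<cdot> gp) + (N \<cdot> Y + z)"
      by (simp add: ac_simps)
    also have "\<dots> \<le> (l \<cdot> gm + l \<cdot> gp) + (N \<cdot> X + z)"
      using catalyst_nmult[OF z] by (rule add_left_mono)
    also have "\<dots> = N \<cdot> X + l \<cdot> gp + (z + l \<cdot> gm)"
      by (simp add: ac_simps)
    also have "\<dots> \<le> N \<cdot> X + l \<cdot> gp + l \<cdot> gp"
      using l(1) by (rule add_left_mono)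
    also have "\<dots> = N \<cdot> X + (l + l) \<cdot> gp"
      by (simp add: nmult_add_left add.assoc)
    finally show ?thesis .
  qed
  then show thesis by (rule that)
qed

text \<open>
  Passing from the vector space to the monoid introduces a multiple \<open>j\<close> and a catalyst.
  Replacing \<open>\<epsilon>\<close> by some \<open>1/b < \<epsilon>/2\<close> leaves half of the tolerance to pay for the
  removal of the catalyst, whose cost per copy becomes negligible after sufficiently many
  repetitions.
\<close>

lemma approximate_order_descends:
  fixes \<epsilon> :: rat
  assumes gen: "generating_pair gp gm" and "\<epsilon> > 0"
    and le: "\<And>\<delta>. \<delta> > 0 \<Longrightarrow> 0 \<le> (to_ovs x - to_ovs y) + \<delta> *\<^sub>Q (to_ovs gp - to_ovs gm)"
  shows "\<exists>n k :: nat. n \<ge> 1 \<and> of_nat k \<le> \<epsilon> * of_nat n \<and> n \<cdot> y + k \<cdot> gm \<le> n \<cdot> x + k \<cdot> gp"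
proof -
  obtain b :: nat where b: "2 / \<epsilon> < of_nat b"
    using reals_Archimedean2 by blast
  with \<open>\<epsilon> > 0\<close> have b1: "b \<ge> 1"
    by (cases "b = 0") (auto simp: divide_less_0_iff)
  have "to_ovs (b \<cdot> y + gm) \<le> to_ovs (b \<cdot> x + gp)"
    using b1 by (intro to_ovs_clear_denominator le) simp_all
  then obtain j :: nat and z where j: "j \<ge> 1"
    and z: "j \<cdot> (b \<cdot> y + gm) + z \<le> j \<cdot> (b \<cdot> x + gp) + z"
    by (auto simp: to_ovs_le_iff)
  obtain m :: nat where
    m: "\<And>N. N \<cdot> j \<cdot> (b \<cdot> y + gm) + m \<cdot> gm \<le> N \<cdot> j \<cdot> (b \<cdot> x + gp) + m \<cdot> gp"
    by (rule catalyst_removal[OF gen z]) blast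
  \<comment> \<open>With more than \<open>m\<close> repetitions, the \<open>m\<close> extra copies of \<open>gp\<close> are at most as many as the
    \<open>N j\<close> copies already present.\<close>
  define N where "N = Suc m"
  let ?n = "N * j * b" and ?k = "N * j + m"
  have "?n \<cdot> y + ?k \<cdot> gm \<le> ?n \<cdot> x + ?k \<cdot> gp"
    using m[of N] by (simp add: nmult_add_right nmult_add_left nmult_nmult add.assoc mult.assoc)
  moreover have "?n \<ge> 1"
    using j b1 by (simp add: N_def)
  moreover have "of_nat ?k \<le> \<epsilon> * of_nat ?n"
  proof -
    have "m \<le> N * j"
      using j mult_le_mono[of m "Suc m" 1 j] by (simp add: N_def)
    then have "rat_of_nat m \<le> of_nat (N * j)"
      by (simp only: of_nat_le_iff)
    then have "rat_of_nat ?k \<le> of_nat (N * j) * 2"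
      by simp
    also have "\<dots> \<le> of_nat (N * j) * (\<epsilon> * of_nat b)"
      using b \<open>\<epsilon> > 0\<close> by (intro mult_left_mono) (simp_all add: field_simps)
    finally show ?thesis by (simp add: ac_simps)
  qed
  ultimately show ?thesis by blast
qed

lemma approximate_order_functional:
  assumes gen: "generating_pair gp gm" and f: "monoid_functional f"
    and b: "\<And>\<epsilon>::rat. \<epsilon> > 0 \<Longrightarrow> \<exists>n k :: nat. n \<ge> 1 \<and> of_nat k \<le> \<epsilon> * of_nat n \<and>
        n \<cdot> y + k \<cdot> gm \<le> n \<cdot> x + k \<cdot> gp"
  shows "f y \<le> f x"
proof -
  note F = f[unfolded monoid_functional_def]
  have nm: "f (n \<cdot> w) = real n * f w" for n w
    by (induction n) (simp_all add: F nmult_Suc distrib_right)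
  let ?d = "f gp - f gm"
  have d: "0 \<le> ?d"
    using gen F by (simp add: generating_pair_def)
  show ?thesis
  proof (rule ccontr)
    assume "\<not> f y \<le> f x"
    \<comment> \<open>The summand \<open>1\<close> keeps the denominator positive if \<open>f gp = f gm\<close>.\<close>
    then have "0 < (f y - f x) / (?d + 1)"
      using d by simp
    then obtain \<epsilon> :: rat where \<epsilon>: "0 < real_of_rat \<epsilon>" "real_of_rat \<epsilon> < (f y - f x) / (?d + 1)"
      using of_rat_dense by blast
    obtain n k :: nat where nk: "n \<ge> 1" "of_nat k \<le> \<epsilon> * of_nat n"
      and le: "n \<cdot> y + k \<cdot> gm \<le> n \<cdot> x + k \<cdot> gp"
      using b[of \<epsilon>] \<epsilon>(1) by (auto simp: zero_less_of_rat_iff)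
    have "f (n \<cdot> y + k \<cdot> gm) \<le> f (n \<cdot> x + k \<cdot> gp)"
      using F le by blast
    then have "real n * (f y - f x) \<le> real k * ?d"
      by (simp add: F nm algebra_simps)
    also have "\<dots> \<le> (of_rat \<epsilon> * real n) * ?d"
    proof (rule mult_right_mono[OF _ d])
      have "real_of_rat (of_nat k) \<le> of_rat (\<epsilon> * of_nat n)"
        using nk(2) by (simp only: of_rat_less_eq)
      then show "real k \<le> of_rat \<epsilon> * real n"
        by (simp add: of_rat_mult)
    qed
    also have "\<dots> = real n * (of_rat \<epsilon> * ?d)"
      by (simp add: ac_simps)
    finally have "f y - f x \<le> of_rat \<epsilon> * ?d"
      using nk(1) by simp
    also have "\<dots> < of_rat \<epsilon> * (?d + 1)"
      using \<epsilon>(1) by simp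
    also have "\<dots> < f y - f x"
      using \<epsilon>(2) d by (simp add: less_divide_eq)
    finally show False .
  qed
qed

section \<open>The equivalence\<close>

theorem theorem6p18:
  fixes gp gm x y :: "'a::ordered_comm_monoid_add"
  assumes "generating_pair gp gm"
  shows
    "(to_aovs x \<ge> to_aovs y \<longleftrightarrow>
      (\<forall>\<epsilon>::rat. \<epsilon> > 0 \<longrightarrow> (\<exists>n k :: nat. n \<ge> 1 \<and> of_nat k \<le> \<epsilon> * of_nat n \<and>
        n \<cdot> x + k \<cdot> gp \<ge> n \<cdot> y + k \<cdot> gm))) \<and>
     ((\<forall>\<epsilon>::rat. \<epsilon> > 0 \<longrightarrow> (\<exists>n k :: nat. n \<ge> 1 \<and> of_nat k \<le> \<epsilon> * of_nat n \<and>
        n \<cdot> x + k \<cdot> gp \<ge> n \<cdot> y + k \<cdot> gm)) \<longleftrightarrow>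
      (\<forall>f. monoid_functional f \<longrightarrow> f x \<ge> f y))"
    (is "(?a \<longleftrightarrow> ?b) \<and> (?b \<longleftrightarrow> ?c)")
proof -
  note unit = generating_pair_order_unit[OF assms]
  have "?b" if ?a
  proof (intro allI impI)
    fix \<epsilon> :: rat
    assume \<epsilon>: "\<epsilon> > 0"
    show "\<exists>n k :: nat. n \<ge> 1 \<and> of_nat k \<le> \<epsilon> * of_nat n \<and> n \<cdot> y + k \<cdot> gm \<le> n \<cdot> x + k \<cdot> gp"
      using that by (intro approximate_order_descends[OF assms \<epsilon>])
        (simp add: to_aovs_le_iff aovs_cone_iff[OF unit])
  qed
  moreover have ?c if ?b
    using that approximate_order_functional[OF assms] by blast
  moreover have ?a if ?c
  proof (rule ccontr)
    assume "\<not> ?a"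
    then have "to_ovs x - to_ovs y \<notin> aovs_cone"
      by (simp add: to_aovs_le_iff)
    then obtain f :: "'a ovs \<Rightarrow> real" where add: "\<And>u w. f (u + w) = f u + f w"
      and pos: "\<And>u. 0 \<le> u \<Longrightarrow> 0 \<le> f u" and neg: "f (to_ovs x - to_ovs y) < 0"
      using separating_positive_additive[OF unit] by metis
    have diff: "f (u - w) = f u - f w" for u w
      using add[of "u - w" w] by simp
    have "monoid_functional (\<lambda>a. f (to_ovs a))"
      unfolding monoid_functional_def
    proof (intro conjI allI impI)
      fix a b :: 'a
      assume "b \<le> a"
      then show "f (to_ovs b) \<le> f (to_ovs a)"
        using pos[of "to_ovs a - to_ovs b"] to_ovs_mono[of b a] by (simp add: diff)
    qed (use add[of 0 0] in \<open>simp_all add: to_ovs_add to_ovs_zero add\<close>)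
    with \<open>?c\<close> have "f (to_ovs y) \<le> f (to_ovs x)" by blast
    with neg show False by (simp add: diff)
  qed
  ultimately show ?thesis by blast
qed

end
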